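(* Let $f_1,\dots,f_n$ satisfy Assumptions A1 and A2. Then for all $\beta,\beta'\in\Delta^{n-1}$, \[\|\nabla x^*(\beta)-\nabla x^*(\beta')\|_{1,2}\le\frac{2L^2R}{\mu^2}\left(1+\frac{L_HR}{\mu}\right)\|\beta-\beta'\|_1.\]
   Context: Assumption A1: each $f_i:\mathbb{R}^d\to\mathbb{R}$ is twice differentiable with $\mu\mathbf{I}\preceq\nabla^2 f_i\preceq L\mathbf{I}$, $0<\mu\le L$. Assumption A2: $\|\nabla^2 f_i(x)-\nabla^2 f_i(y)\|_2\le L_H\|x-y\|_2$ for all $x,y,i$. $F=(f_1,\dots,f_n)$, $\nabla F(x)\in\mathbb{R}^{n\times d}$ its Jacobian, $\Delta^{n-1}$ the simplex, $f_\beta=\sum_i\beta_if_i$, $x^*(\beta)=x_\beta=\operatorname{argmin}_xf_\beta(x)$, with $\nabla x^*(\beta)=-\nabla^2f_\beta(x_\beta)^{-1}\nabla F(x_\beta)^\top$. $R$ is the $\ell_2$-diameter of the Pareto set of $F$ (points $x$ with $\nabla f_\beta(x)=0$ for some $\beta$). $\|A\|_{1,2}:=\sup_{\|z\|_1=1}\|Az\|_2$. *)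

theory Defs
  imports "HOL-Analysis.Analysis"
begin

text \<open>Vectors x in R^d are \<open>real^'d\<close>; the n objectives are indexed by a finite type \<open>'n\<close>.
  \<open>g i x\<close> is the gradient and \<open>H i x\<close> the Hessian of \<open>f i\<close> at \<open>x\<close>.\<close>

definition std_simplex :: "(real^'n::finite) set" where
  "std_simplex = {b. (\<forall>i. 0 \<le> b $ i) \<and> (\<Sum>i\<in>UNIV. b $ i) = 1}"

definition norm1 :: "real^'n::finite \<Rightarrow> real" where
  "norm1 z = (\<Sum>i\<in>UNIV. \<bar>z $ i\<bar>)"

text \<open>Loewner order on (square) matrices: A \<preceq> B iff v^T A v \<le> v^T B v for all v.\<close>
definition loewner_le :: "real^'d^'d \<Rightarrow> real^'d^'d \<Rightarrow> bool" where
  "loewner_le A B \<longleftrightarrow> (\<forall>v. v \<bullet> (A *v v) \<le> v \<bullet> (B *v v))"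

text \<open>Induced l2 operator norm of a matrix.\<close>
definition op_norm2 :: "real^'m^'k \<Rightarrow> real" where
  "op_norm2 A = onorm (\<lambda>v. A *v v)"

text \<open>The (1,2)-norm: sup over ||z||_1 = 1 of ||A z||_2.\<close>
definition norm12 :: "real^'n^'d \<Rightarrow> real" where
  "norm12 A = (SUP z\<in>{z. norm1 z = 1}. norm (A *v z))"

text \<open>Weighted objective f_beta, its Hessian, and the minimizer x*(beta).\<close>
definition fbeta :: "('n::finite \<Rightarrow> real^'d \<Rightarrow> real) \<Rightarrow> real^'n \<Rightarrow> real^'d \<Rightarrow> real" where
  "fbeta f b x = (\<Sum>i\<in>UNIV. b $ i * f i x)"

definition Hbeta :: "('n::finite \<Rightarrow> real^'d \<Rightarrow> real^'d^'d) \<Rightarrow> real^'n \<Rightarrow> real^'d \<Rightarrow> real^'d^'d" where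
  "Hbeta H b x = (\<Sum>i\<in>UNIV. b $ i *\<^sub>R H i x)"

definition xstar :: "('n::finite \<Rightarrow> real^'d \<Rightarrow> real) \<Rightarrow> real^'n \<Rightarrow> real^'d" where
  "xstar f b = (THE x. \<forall>y. fbeta f b x \<le> fbeta f b y)"

text \<open>Jacobian of F = (f_1,...,f_n): the n x d matrix whose i-th row is grad f_i.\<close>
definition JacF :: "('n::finite \<Rightarrow> real^'d \<Rightarrow> real^'d) \<Rightarrow> real^'d \<Rightarrow> real^'d^'n" where
  "JacF g x = (\<chi> i. g i x)"

text \<open>grad x*(beta) = - (Hess f_beta(x_beta))^{-1} (grad F(x_beta))^T, a d x n matrix.\<close>
definition Dxstar :: "('n::finite \<Rightarrow> real^'d \<Rightarrow> real) \<Rightarrow> ('n \<Rightarrow> real^'d \<Rightarrow> real^'d)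
    \<Rightarrow> ('n::finite \<Rightarrow> real^'d \<Rightarrow> real^'d^'d) \<Rightarrow> real^'n \<Rightarrow> real^'n^'d" where
  "Dxstar f g H b = - (matrix_inv (Hbeta H b (xstar f b)) ** transpose (JacF g (xstar f b)))"

text \<open>Pareto set: points that are stationary for some f_beta, beta in the std_simplex.\<close>
definition pareto_set :: "('n::finite \<Rightarrow> real^'d \<Rightarrow> real^'d) \<Rightarrow> (real^'d) set" where
  "pareto_set g = {x. \<exists>b\<in>std_simplex. (\<Sum>i\<in>UNIV. b $ i *\<^sub>R g i x) = 0}"

end

theory Submission
  imports Defs
begin

(*
  Every f_i, and hence every convex combination f_beta, is mu-strongly convex and L-smooth,
  so x_beta is the unique zero of grad f_beta and the Hessian H_beta = hess f_beta(x_beta)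
  satisfies norm (H_beta v) >= mu * norm v.  Since grad f_i vanishes at x_(e_i), a point of
  the Pareto set, norm (grad f_i(x_beta)) <= L R; comparing grad f_beta at x_beta and x_beta'
  gives norm (x_beta - x_beta') <= L R / mu * norm1 (beta - beta').  For norm1 z = 1 the vectors
  w = grad x*(beta) z and w' = grad x*(beta') z solve H_beta w = - grad F(x_beta)^T z, so
  norm w <= L R / mu, and H_beta' (w' - w) = grad F(x_beta)^T z - grad F(x_beta')^T z
  + (H_beta - H_beta') w, whose terms are bounded by the Lipschitz constants of grad f_i
  and of the Hessians.
*)

lemma has_derivative_norm_le_lipschitz:
  fixes \<phi> :: "'a::real_normed_vector \<Rightarrow> 'b::real_normed_vector"
  assumes deriv: "(\<phi> has_derivative \<phi>') (at x)"
    and lipschitz: "\<And>y. norm (\<phi> y - \<phi> x) \<le> B * norm (y - x)"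
  shows "norm (\<phi>' h) \<le> B * norm h"
proof (cases "h = 0")
  case True
  then show ?thesis using linear_0[OF has_derivative_linear[OF deriv]] by simp
next
  case False
  interpret \<phi>': bounded_linear \<phi>' using deriv by (rule has_derivative_bounded_linear)
  define q where "q k = norm (\<phi> (x + k) - \<phi> x - \<phi>' k) / norm k" for k
  have "(q \<longlongrightarrow> 0) (at 0)"
    using deriv unfolding q_def has_derivative_at by blast
  moreover have "filterlim (\<lambda>t::real. t *\<^sub>R h) (at 0) (at 0)"
    using False by (auto simp: filterlim_at eventually_at_filter intro!: tendsto_eq_intros)
  ultimately have lim: "((\<lambda>t. q (t *\<^sub>R h)) \<longlongrightarrow> 0) (at 0)"
    by (rule filterlim_compose)
  have "(norm (\<phi>' h) - B * norm h) / norm h \<le> q (t *\<^sub>R h)" if "t \<noteq> 0" for t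
  proof -
    have "\<bar>t\<bar> * norm (\<phi>' h) - \<bar>t\<bar> * (B * norm h)
        \<le> norm (\<phi> (x + t *\<^sub>R h) - \<phi> x - \<phi>' (t *\<^sub>R h))"
      using lipschitz[of "x + t *\<^sub>R h"]
        norm_triangle_ineq2[of "t *\<^sub>R \<phi>' h" "\<phi> (x + t *\<^sub>R h) - \<phi> x"]
      by (simp add: norm_minus_commute algebra_simps \<phi>'.scale)
    then have "(\<bar>t\<bar> * norm (\<phi>' h) - \<bar>t\<bar> * (B * norm h)) / norm (t *\<^sub>R h)
        \<le> q (t *\<^sub>R h)"
      unfolding q_def by (simp add: divide_right_mono)
    then show ?thesis
      using that by (simp add: right_diff_distrib[symmetric])
  qed
  then have "(norm (\<phi>' h) - B * norm h) / norm h \<le> 0"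
    by (intro tendsto_lowerbound[OF lim]) (auto simp: eventually_at_filter)
  then show ?thesis using False by (simp add: divide_le_0_iff)
qed

locale strongly_convex_smooth =
  fixes f :: "'a::real_inner \<Rightarrow> real"
    and g :: "'a \<Rightarrow> 'a"
    and H :: "'a \<Rightarrow> 'a \<Rightarrow> 'a"
    and \<mu> L :: real
  assumes gradient: "\<And>x. (f has_derivative (\<lambda>h. g x \<bullet> h)) (at x)"
    and hessian: "\<And>x. (g has_derivative H x) (at x)"
    and mu_pos: "0 < \<mu>" and mu_le_L: "\<mu> \<le> L"
    and hessian_lower: "\<And>x v. \<mu> * (v \<bullet> v) \<le> v \<bullet> H x v"
    and hessian_upper: "\<And>x v. v \<bullet> H x v \<le> L * (v \<bullet> v)"
begin

lemma L_pos: "0 < L"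
  using mu_pos mu_le_L by linarith

lemma taylor_lagrange: "\<exists>\<xi>. f y = f x + g x \<bullet> (y - x) + (y - x) \<bullet> H \<xi> (y - x) / 2"
proof -
  define h where "h = y - x"
  define p where "p t = x + t *\<^sub>R h" for t :: real
  define d where "d m = (if m = 0 then (\<lambda>t. f (p t)) else if m = 1 then (\<lambda>t. g (p t) \<bullet> h)
      else (\<lambda>t. h \<bullet> H (p t) h))" for m :: nat
  have p: "(p has_derivative (\<lambda>s. s *\<^sub>R h)) (at t)" for t
    unfolding p_def by (auto intro!: derivative_eq_intros)
  have "DERIV (d 0) t :> d 1 t" for t
    using has_derivative_compose[OF p gradient]
    by (simp add: d_def has_field_derivative_def mult_commute_abs)
  moreover have "DERIV (d 1) t :> d 2 t" for t
  proof -
    interpret H: linear "H (p t)" using hessian by (rule has_derivative_linear)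
    have "((\<lambda>t. g (p t) \<bullet> h) has_derivative (\<lambda>s. H (p t) (s *\<^sub>R h) \<bullet> h)) (at t)"
      using has_derivative_compose[OF p hessian] by (rule has_derivative_inner_left)
    then show ?thesis
      by (simp add: d_def has_field_derivative_def H.scale mult_commute_abs inner_commute)
  qed
  ultimately have "\<forall>m t. m < 2 \<and> 0 \<le> t \<and> t \<le> 1 \<longrightarrow> DERIV (d m) t :> d (Suc m) t"
    by (auto simp: numeral_2_eq_2 less_Suc_eq)
  then obtain t where "d 0 1 = (\<Sum>m<2. d m 0 / fact m * 1 ^ m) + d 2 t / fact 2 * 1 ^ 2"
    using Maclaurin[OF zero_less_one, of 2 d "d 0"] by auto
  then have "f y = f x + g x \<bullet> h + h \<bullet> H (p t) h / 2"
    by (simp add: d_def p_def h_def eval_nat_numeral)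
  then show ?thesis unfolding h_def by blast
qed

lemma strongly_convex: "f x + g x \<bullet> (y - x) + \<mu> / 2 * (norm (y - x))\<^sup>2 \<le> f y"
proof -
  obtain \<xi> where "f y = f x + g x \<bullet> (y - x) + (y - x) \<bullet> H \<xi> (y - x) / 2"
    using taylor_lagrange by blast
  with hessian_lower[of "y - x" \<xi>] show ?thesis by (simp add: power2_norm_eq_inner)
qed

lemma smooth: "f y \<le> f x + g x \<bullet> (y - x) + L / 2 * (norm (y - x))\<^sup>2"
proof -
  obtain \<xi> where "f y = f x + g x \<bullet> (y - x) + (y - x) \<bullet> H \<xi> (y - x) / 2"
    using taylor_lagrange by blast
  with hessian_upper[of "y - x" \<xi>] show ?thesis by (simp add: power2_norm_eq_inner)
qed

lemma gradient_strongly_monotone: "\<mu> * (norm (y - x))\<^sup>2 \<le> (g y - g x) \<bullet> (y - x)"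
proof -
  have "norm (x - y) = norm (y - x)" "g y \<bullet> (x - y) = - (g y \<bullet> (y - x))"
    by (simp_all add: norm_minus_commute inner_diff_right)
  then show ?thesis
    using strongly_convex[of x y] strongly_convex[of y x] by (simp add: inner_diff_left)
qed

lemma root_distance_le:
  assumes "g z = 0"
  shows "\<mu> * norm (x - z) \<le> norm (g x)"
proof -
  have "\<mu> * norm (x - z) * norm (x - z) \<le> g x \<bullet> (x - z)"
    using gradient_strongly_monotone[of x z] assms by (simp add: power2_eq_square)
  also have "\<dots> \<le> norm (g x) * norm (x - z)"
    by (rule norm_cauchy_schwarz)
  finally show ?thesis
    by (cases "norm (x - z) = 0") (use mu_pos in auto)
qed

(* Convexity below f at the gradient step z = y - (g y - g x) / L, against smoothness above it. *)
lemma gradient_cocoercive: "(norm (g y - g x))\<^sup>2 / (2 * L) \<le> f y - f x - g x \<bullet> (y - x)"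
proof -
  define h where "h = g y - g x"
  define z where "z = y - h /\<^sub>R L"
  have "0 \<le> \<mu> / 2 * (norm (z - x))\<^sup>2"
    using mu_pos by simp
  then have "f x + g x \<bullet> (z - x) \<le> f z"
    using strongly_convex[of x z] by linarith
  moreover have "g x \<bullet> (z - x) = g x \<bullet> (y - x) - g x \<bullet> h / L"
    by (simp add: z_def inner_diff_right divide_inverse mult.commute)
  moreover have "f z \<le> f y + g y \<bullet> (z - y) + L / 2 * (norm (z - y))\<^sup>2"
    by (rule smooth)
  moreover have "g y \<bullet> (z - y) = - (g y \<bullet> h / L)"
    by (simp add: z_def divide_inverse mult.commute)
  moreover have "L / 2 * (norm (z - y))\<^sup>2 = (norm h)\<^sup>2 / (2 * L)"
  proof -
    have "norm (z - y) = norm h / L"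
      using L_pos by (simp add: z_def divide_inverse mult.commute)
    then show ?thesis
      using L_pos by (simp add: power2_eq_square)
  qed
  moreover have "g y \<bullet> h / L - g x \<bullet> h / L = (norm h)\<^sup>2 / L"
    by (simp add: h_def power2_norm_eq_inner inner_diff_left diff_divide_distrib[symmetric])
  moreover have "(norm h)\<^sup>2 / L = (norm h)\<^sup>2 / (2 * L) + (norm h)\<^sup>2 / (2 * L)"
    by simp
  ultimately show ?thesis unfolding h_def[symmetric] by linarith
qed

lemma gradient_lipschitz: "norm (g y - g x) \<le> L * norm (y - x)"
proof -
  define h where "h = g y - g x"
  have swap: "norm (g x - g y) = norm h"
    by (simp add: h_def norm_minus_commute)
  have "g y \<bullet> (x - y) = - (g y \<bullet> (y - x))"
    and "h \<bullet> (y - x) = g y \<bullet> (y - x) - g x \<bullet> (y - x)"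
    by (simp_all add: h_def inner_diff_left inner_diff_right)
  moreover have "(norm h)\<^sup>2 / L = (norm h)\<^sup>2 / (2 * L) + (norm h)\<^sup>2 / (2 * L)"
    by simp
  ultimately have "(norm h)\<^sup>2 / L \<le> h \<bullet> (y - x)"
    using gradient_cocoercive[of y x] gradient_cocoercive[of x y, unfolded swap] unfolding h_def[symmetric]
    by linarith
  also have "\<dots> \<le> norm h * norm (y - x)"
    by (rule norm_cauchy_schwarz)
  finally have "norm h * norm h \<le> norm h * (L * norm (y - x))"
    using L_pos by (simp add: power2_eq_square pos_divide_le_eq mult_ac)
  then show ?thesis
    unfolding h_def[symmetric] by (cases "norm h = 0") (use L_pos in auto)
qed

(* H x need not be symmetric, so the quadratic-form bounds do not bound its norm; the
   Lipschitz gradient does. *)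
lemma hessian_norm_le: "norm (H x v) \<le> L * norm v"
  using hessian gradient_lipschitz by (rule has_derivative_norm_le_lipschitz)

lemma hessian_coercive: "\<mu> * norm v \<le> norm (H x v)"
proof -
  have "\<mu> * norm v * norm v \<le> norm v * norm (H x v)"
    using hessian_lower[of v x] norm_cauchy_schwarz[of v "H x v"]
    by (simp add: power2_norm_eq_inner[symmetric] power2_eq_square)
  then show ?thesis
    by (cases "norm v = 0") (auto simp: mult.commute)
qed

lemma the_minimizer_eqI:
  assumes "g z = 0"
  shows "(THE x. \<forall>y. f x \<le> f y) = z"
proof (rule the_equality)
  show "\<forall>y. f z \<le> f y"
  proof
    fix y
    have "0 \<le> \<mu> / 2 * (norm (y - z))\<^sup>2"
      using mu_pos by simp
    then show "f z \<le> f y"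
      using strongly_convex[of z y] assms by simp
  qed
  fix x
  assume "\<forall>y. f x \<le> f y"
  then have "\<mu> / 2 * (norm (x - z))\<^sup>2 \<le> 0"
    using strongly_convex[of z x] assms by (metis add.right_neutral add_le_cancel_left
        inner_zero_left order_trans)
  then show "x = z"
    using mu_pos by (simp add: mult_le_0_iff)
qed

end

lemma strongly_convex_smooth_gradient_root:
  fixes f :: "'a::euclidean_space \<Rightarrow> real"
  assumes "strongly_convex_smooth f g H \<mu> L"
  obtains z where "g z = 0"
proof -
  interpret strongly_convex_smooth f g H \<mu> L by fact
  define r where "r = 2 * norm (g 0) / \<mu>"
  have "continuous_on (cball 0 r) f"
    using gradient by (meson continuous_at_imp_continuous_on has_derivative_continuous)
  moreover have "0 \<in> cball 0 r"
    using mu_pos by (simp add: r_def)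
  ultimately obtain x where x: "\<And>y. y \<in> cball 0 r \<Longrightarrow> f x \<le> f y"
    using continuous_attains_inf[OF compact_cball] by blast
  have "f 0 \<le> f y" if "y \<notin> cball 0 r" for y
  proof -
    have "norm (g 0) \<le> \<mu> / 2 * norm y"
      using that mu_pos by (simp add: r_def field_simps)
    then have "norm (g 0) * norm y \<le> \<mu> / 2 * norm y * norm y"
      by (rule mult_right_mono) simp
    moreover have "- (norm (g 0) * norm y) \<le> g 0 \<bullet> y"
      using norm_cauchy_schwarz[of "- g 0" y] by simp
    ultimately show ?thesis
      using strongly_convex[of 0 y] by (simp add: power2_eq_square)
  qed
  then have "\<forall>y. f x \<le> f y"
    using x \<open>0 \<in> cball 0 r\<close> by (meson order_trans)
  then have "(\<lambda>h. g x \<bullet> h) = (\<lambda>h. 0)"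
    by (intro differential_zero_maxmin[of x UNIV f] gradient) auto
  then have "g x \<bullet> g x = 0"
    by metis
  then show ?thesis using that by simp
qed

lemma strongly_convex_smooth_gradient_the_minimizer:
  fixes f :: "'a::euclidean_space \<Rightarrow> real"
  assumes "strongly_convex_smooth f g H \<mu> L"
  shows "g (THE x. \<forall>y. f x \<le> f y) = 0"
  using strongly_convex_smooth_gradient_root[OF assms]
    strongly_convex_smooth.the_minimizer_eqI[OF assms] by metis

lemma std_simplex_nonneg: "b \<in> std_simplex \<Longrightarrow> 0 \<le> b $ i"
  by (simp add: std_simplex_def)

lemma std_simplex_sum: "b \<in> std_simplex \<Longrightarrow> (\<Sum>i\<in>UNIV. b $ i) = 1"
  by (simp add: std_simplex_def)

lemma norm1_std_simplex: "b \<in> std_simplex \<Longrightarrow> norm1 b = 1"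
  by (simp add: norm1_def std_simplex_def)

lemma axis_in_std_simplex: "axis i 1 \<in> std_simplex"
  by (simp add: std_simplex_def axis_def)

lemma norm1_nonneg: "0 \<le> norm1 z"
  by (simp add: norm1_def sum_nonneg)

lemma norm_sum_scaleR_le_norm1:
  assumes "\<And>i. norm (v i) \<le> C"
  shows "norm (\<Sum>i\<in>UNIV. z $ i *\<^sub>R v i) \<le> norm1 z * C"
proof -
  have "norm (\<Sum>i\<in>UNIV. z $ i *\<^sub>R v i) \<le> (\<Sum>i\<in>UNIV. \<bar>z $ i\<bar> * norm (v i))"
    using norm_sum[of "\<lambda>i. z $ i *\<^sub>R v i"] by simp
  also have "\<dots> \<le> (\<Sum>i\<in>UNIV. \<bar>z $ i\<bar> * C)"
    by (intro sum_mono mult_left_mono assms) simp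
  finally show ?thesis
    by (simp add: norm1_def sum_distrib_right)
qed

lemma norm12_le:
  assumes "\<And>z. norm1 z = 1 \<Longrightarrow> norm (A *v z) \<le> c"
  shows "norm12 A \<le> c"
  unfolding norm12_def
proof (rule cSUP_least)
  show "{z. norm1 z = 1} \<noteq> {}"
    using norm1_std_simplex[OF axis_in_std_simplex] by blast
qed (use assms in auto)

lemma op_norm2_lipschitz_const_nonneg:
  fixes M :: "real^'d::finite \<Rightarrow> real^'m::finite^'k::finite"
  assumes "\<And>x y. op_norm2 (M x - M y) \<le> K * norm (x - y)"
  shows "0 \<le> K"
proof -
  have "0 \<le> op_norm2 (M 0 - M (axis k 1))"
    unfolding op_norm2_def by (rule onorm_pos_le) simp
  also have "\<dots> \<le> K * norm (0 - axis k (1::real))"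
    by (rule assms)
  finally show ?thesis
    by (simp add: zero_le_mult_iff)
qed

lemma matrix_vector_mult_op_norm2_le: "norm (A *v v) \<le> op_norm2 A * norm v"
  unfolding op_norm2_def by (rule onorm) simp

lemma matrix_vector_mult_uminus:
  fixes A :: "'a::comm_ring_1^'n::finite^'m"
  shows "(- A) *v v = - (A *v v)" and "A *v (- v) = - (A *v v)"
  by (simp_all add: vec_eq_iff matrix_vector_mult_def sum_negf)

lemma coercive_matrix_invertible:
  fixes A :: "real^'n::finite^'n"
  assumes "0 < \<mu>" and "\<And>v. \<mu> * norm v \<le> norm (A *v v)"
  shows "invertible A"
proof -
  have "inj ((*v) A)"
  proof (rule injI)
    fix v w
    assume "A *v v = A *v w"
    then have "\<mu> * norm (v - w) \<le> 0"
      using assms(2)[of "v - w"] by (simp add: matrix_vector_mult_diff_distrib)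
    then show "v = w"
      using assms(1) by (simp add: mult_le_0_iff)
  qed
  then show ?thesis
    using matrix_left_invertible_injective invertible_left_inverse by blast
qed

lemma matrix_inv_right_apply:
  fixes A :: "real^'n::finite^'n"
  assumes "invertible A"
  shows "A *v (matrix_inv A *v u) = u"
proof -
  have "A ** matrix_inv A = mat 1"
    using someI_ex[OF assms[unfolded invertible_def]] by (simp add: matrix_inv_def)
  then show ?thesis
    by (simp add: matrix_vector_mul_assoc)
qed

lemma coercive_perturbation:
  fixes A B :: "real^'n::finite^'n"
  assumes "\<And>v. \<mu> * norm v \<le> norm (B *v v)"
  shows "\<mu> * norm (w' - w) \<le> norm (B *v w' - A *v w) + norm ((A - B) *v w)"
proof -
  have "B *v (w' - w) = (B *v w' - A *v w) + (A - B) *v w"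
    by (simp add: matrix_vector_mult_diff_distrib matrix_vector_mult_diff_rdistrib)
  then show ?thesis
    using assms[of "w' - w"] norm_triangle_ineq order_trans by metis
qed

definition gbeta ::
    "('n::finite \<Rightarrow> real^'d \<Rightarrow> real^'d) \<Rightarrow> real^'n \<Rightarrow> real^'d \<Rightarrow> real^'d" where
  "gbeta g b x = (\<Sum>i\<in>UNIV. b $ i *\<^sub>R g i x)"

lemma gbeta_axis: "gbeta g (axis i 1) x = g i x"
  by (simp add: gbeta_def axis_def if_distrib[of "\<lambda>c. c *\<^sub>R _"] cong: if_cong)

lemma pareto_set_gbeta: "pareto_set g = {x. \<exists>b\<in>std_simplex. gbeta g b x = 0}"
  by (simp add: pareto_set_def gbeta_def)

lemma transpose_JacF_mult: "transpose (JacF g x) *v z = gbeta g z x"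
  by (simp add: JacF_def gbeta_def vec_eq_iff matrix_vector_mult_def transpose_def
      sum_component mult.commute)

lemma Hbeta_mult: "Hbeta H b x *v v = (\<Sum>i\<in>UNIV. b $ i *\<^sub>R (H i x *v v))"
  unfolding Hbeta_def
  by (simp add: vec_eq_iff matrix_vector_mult_def sum_component sum_distrib_left
      sum_distrib_right mult.assoc) (subst sum.swap, simp add: sum_distrib_left)

lemma strongly_convex_smooth_matrixI:
  fixes f :: "real^'d::finite \<Rightarrow> real" and H :: "real^'d \<Rightarrow> real^'d^'d"
  assumes "\<And>x. (f has_derivative (\<lambda>h. g x \<bullet> h)) (at x)"
    and "\<And>x. (g has_derivative (\<lambda>h. H x *v h)) (at x)"
    and "0 < \<mu>" and "\<mu> \<le> L"
    and "\<And>x. loewner_le (\<mu> *\<^sub>R mat 1) (H x)"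
    and "\<And>x. loewner_le (H x) (L *\<^sub>R mat 1)"
  shows "strongly_convex_smooth f g (\<lambda>x. (*v) (H x)) \<mu> L"
  using assms unfolding loewner_le_def
  by unfold_locales (auto simp: scaleR_matrix_vector_assoc[symmetric])

lemma strongly_convex_smooth_fbeta:
  assumes component: "\<And>i. strongly_convex_smooth (f i) (g i) (\<lambda>x. (*v) (H i x)) \<mu> L"
    and b: "b \<in> std_simplex"
  shows "strongly_convex_smooth (fbeta f b) (gbeta g b) (\<lambda>x. (*v) (Hbeta H b x)) \<mu> L"
proof
  fix x
  have "((\<lambda>x. \<Sum>i\<in>UNIV. b $ i * f i x)
      has_derivative (\<lambda>h. \<Sum>i\<in>UNIV. b $ i * (g i x \<bullet> h))) (at x)"
    by (intro has_derivative_sum has_derivative_mult_right strongly_convex_smooth.gradient[OF component])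
  then show "(fbeta f b has_derivative (\<lambda>h. gbeta g b x \<bullet> h)) (at x)"
    by (simp add: fbeta_def[abs_def] gbeta_def inner_sum_left)
  have "((\<lambda>x. \<Sum>i\<in>UNIV. b $ i *\<^sub>R g i x)
      has_derivative (\<lambda>h. \<Sum>i\<in>UNIV. b $ i *\<^sub>R (H i x *v h))) (at x)"
    by (intro has_derivative_sum has_derivative_scaleR_right strongly_convex_smooth.hessian[OF component])
  then show "(gbeta g b has_derivative (*v) (Hbeta H b x)) (at x)"
    by (simp only: gbeta_def[abs_def] Hbeta_mult[symmetric])
next
  show "0 < \<mu>" "\<mu> \<le> L"
    using strongly_convex_smooth.mu_pos strongly_convex_smooth.mu_le_L component by blast+
next
  fix x v
  have Hv: "v \<bullet> (Hbeta H b x *v v) = (\<Sum>i\<in>UNIV. b $ i * (v \<bullet> (H i x *v v)))"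
    by (simp add: Hbeta_mult inner_sum_right)
  have "\<mu> * (v \<bullet> v) = (\<Sum>i\<in>UNIV. b $ i * (\<mu> * (v \<bullet> v)))"
    using std_simplex_sum[OF b] by (simp add: sum_distrib_right[symmetric])
  also have "\<dots> \<le> v \<bullet> (Hbeta H b x *v v)"
    unfolding Hv using strongly_convex_smooth.hessian_lower[OF component] std_simplex_nonneg[OF b]
    by (intro sum_mono mult_left_mono) auto
  finally show "\<mu> * (v \<bullet> v) \<le> v \<bullet> (Hbeta H b x *v v)" .
  have "v \<bullet> (Hbeta H b x *v v) \<le> (\<Sum>i\<in>UNIV. b $ i * (L * (v \<bullet> v)))"
    unfolding Hv using strongly_convex_smooth.hessian_upper[OF component] std_simplex_nonneg[OF b]
    by (intro sum_mono mult_left_mono) auto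
  also have "\<dots> = L * (v \<bullet> v)"
    using std_simplex_sum[OF b] by (simp add: sum_distrib_right[symmetric])
  finally show "v \<bullet> (Hbeta H b x *v v) \<le> L * (v \<bullet> v)" .
qed

lemma gbeta_diff_weights: "gbeta g b x - gbeta g b' x = gbeta g (b - b') x"
  by (simp add: gbeta_def sum_subtractf[symmetric] scaleR_diff_left)

lemma gbeta_diff_points: "gbeta g z x - gbeta g z y = (\<Sum>i\<in>UNIV. z $ i *\<^sub>R (g i x - g i y))"
  by (simp add: gbeta_def sum_subtractf[symmetric] scaleR_diff_right)

locale strongly_convex_smooth_family =
  fixes f :: "'n::finite \<Rightarrow> real^'d::finite \<Rightarrow> real"
    and g :: "'n \<Rightarrow> real^'d \<Rightarrow> real^'d"
    and H :: "'n \<Rightarrow> real^'d \<Rightarrow> real^'d^'d"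
    and \<mu> L :: real
  assumes component: "\<And>i. strongly_convex_smooth (f i) (g i) (\<lambda>x. (*v) (H i x)) \<mu> L"
begin

lemma fbeta_strongly_convex_smooth:
  "b \<in> std_simplex \<Longrightarrow>
    strongly_convex_smooth (fbeta f b) (gbeta g b) (\<lambda>x. (*v) (Hbeta H b x)) \<mu> L"
  using component by (rule strongly_convex_smooth_fbeta)

lemma mu_pos: "0 < \<mu>"
  using strongly_convex_smooth.mu_pos[OF component] .

lemma L_pos: "0 < L"
  using strongly_convex_smooth.L_pos[OF component] .

lemma gbeta_xstar: "b \<in> std_simplex \<Longrightarrow> gbeta g b (xstar f b) = 0"
  unfolding xstar_def by (rule strongly_convex_smooth_gradient_the_minimizer[OF fbeta_strongly_convex_smooth])

lemma xstar_in_pareto_set: "b \<in> std_simplex \<Longrightarrow> xstar f b \<in> pareto_set g"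
  using gbeta_xstar by (auto simp: pareto_set_gbeta)

lemma bounded_pareto_set: "bounded (pareto_set g)"
proof -
  define M where "M = (\<Sum>j\<in>UNIV. norm (g j 0))"
  have "\<mu> * norm x \<le> M" if x: "x \<in> pareto_set g" for x
  proof -
    obtain b where b: "b \<in> std_simplex" and "gbeta g b x = 0"
      using x by (auto simp: pareto_set_gbeta)
    then have "\<mu> * norm (0 - x) \<le> norm (gbeta g b 0)"
      by (intro strongly_convex_smooth.root_distance_le[OF fbeta_strongly_convex_smooth])
    also have "\<dots> \<le> norm1 b * M"
      unfolding gbeta_def M_def by (intro norm_sum_scaleR_le_norm1 member_le_sum) auto
    finally show ?thesis
      using norm1_std_simplex[OF b] by simp
  qed
  then have "\<forall>x\<in>pareto_set g. norm x \<le> M / \<mu>"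
    using mu_pos by (simp add: field_simps)
  then show ?thesis
    unfolding bounded_iff by blast
qed

lemma norm_gradient_xstar_le:
  assumes "b \<in> std_simplex"
  shows "norm (g i (xstar f b)) \<le> L * diameter (pareto_set g)"
proof -
  define z where "z = xstar f (axis i 1)"
  have "g i z = 0"
    using gbeta_xstar[OF axis_in_std_simplex] by (simp add: z_def gbeta_axis)
  then have "norm (g i (xstar f b)) \<le> L * norm (xstar f b - z)"
    using strongly_convex_smooth.gradient_lipschitz[OF component, of i "xstar f b" z] by simp
  also have "\<dots> \<le> L * diameter (pareto_set g)"
    using diameter_bounded_bound[OF bounded_pareto_set xstar_in_pareto_set[OF assms]
        xstar_in_pareto_set[OF axis_in_std_simplex, of i]] L_pos
    by (simp add: z_def dist_norm)
  finally show ?thesis .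
qed

lemma norm_gbeta_xstar_le:
  "b \<in> std_simplex \<Longrightarrow> norm (gbeta g z (xstar f b)) \<le> norm1 z * (L * diameter (pareto_set g))"
  unfolding gbeta_def by (intro norm_sum_scaleR_le_norm1 norm_gradient_xstar_le)

lemma gbeta_lipschitz: "norm (gbeta g z x - gbeta g z y) \<le> norm1 z * (L * norm (x - y))"
  unfolding gbeta_diff_points
  by (intro norm_sum_scaleR_le_norm1 strongly_convex_smooth.gradient_lipschitz[OF component])

lemma xstar_lipschitz:
  assumes b: "b \<in> std_simplex" and b': "b' \<in> std_simplex"
  shows "norm (xstar f b - xstar f b') \<le> L * diameter (pareto_set g) / \<mu> * norm1 (b - b')"
proof -
  have "\<mu> * norm (xstar f b' - xstar f b) \<le> norm (gbeta g b (xstar f b'))"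
    using strongly_convex_smooth.root_distance_le[OF fbeta_strongly_convex_smooth[OF b] gbeta_xstar[OF b]] .
  also have "\<dots> = norm (gbeta g (b - b') (xstar f b'))"
    using gbeta_xstar[OF b'] gbeta_diff_weights[of g b "xstar f b'" b'] by simp
  also have "\<dots> \<le> norm1 (b - b') * (L * diameter (pareto_set g))"
    using b' by (rule norm_gbeta_xstar_le)
  finally show ?thesis
    using mu_pos by (simp add: norm_minus_commute field_simps)
qed

lemma Hbeta_invertible: "b \<in> std_simplex \<Longrightarrow> invertible (Hbeta H b x)"
  using mu_pos strongly_convex_smooth.hessian_coercive[OF fbeta_strongly_convex_smooth]
  by (rule coercive_matrix_invertible)

lemma Hbeta_Dxstar:
  assumes "b \<in> std_simplex"
  shows "Hbeta H b (xstar f b) *v (Dxstar f g H b *v z) = - gbeta g z (xstar f b)"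
  using matrix_inv_right_apply[OF Hbeta_invertible[OF assms]]
  by (simp add: Dxstar_def matrix_vector_mult_uminus matrix_vector_mul_assoc[symmetric]
      transpose_JacF_mult del: transpose_matrix_vector)

lemma Hbeta_diff_le:
  assumes lip: "\<And>i x y. op_norm2 (H i x - H i y) \<le> L\<^sub>H * norm (x - y)"
    and b': "b' \<in> std_simplex"
  shows "norm ((Hbeta H b x - Hbeta H b' x') *v w)
    \<le> (L * norm1 (b - b') + L\<^sub>H * norm (x - x')) * norm w"
proof -
  have "(Hbeta H b x - Hbeta H b' x') *v w
      = (\<Sum>i\<in>UNIV. (b - b') $ i *\<^sub>R (H i x *v w))
        + (\<Sum>i\<in>UNIV. b' $ i *\<^sub>R ((H i x - H i x') *v w))"
    by (simp add: matrix_vector_mult_diff_rdistrib Hbeta_mult sum_subtractf[symmetric]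
        sum.distrib[symmetric] scaleR_diff_left scaleR_diff_right)
  also have "norm \<dots> \<le> norm1 (b - b') * (L * norm w) + norm1 b' * (L\<^sub>H * norm (x - x') * norm w)"
  proof (rule norm_triangle_le[OF add_mono])
    show "norm (\<Sum>i\<in>UNIV. (b - b') $ i *\<^sub>R (H i x *v w)) \<le> norm1 (b - b') * (L * norm w)"
      by (intro norm_sum_scaleR_le_norm1 strongly_convex_smooth.hessian_norm_le[OF component])
    show "norm (\<Sum>i\<in>UNIV. b' $ i *\<^sub>R ((H i x - H i x') *v w))
        \<le> norm1 b' * (L\<^sub>H * norm (x - x') * norm w)"
      by (intro norm_sum_scaleR_le_norm1 order_trans[OF matrix_vector_mult_op_norm2_le]
          mult_right_mono lip) simp
  qed
  finally show ?thesis
    using norm1_std_simplex[OF b'] by (simp add: algebra_simps)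
qed

lemma norm_Dxstar_apply_le:
  assumes "b \<in> std_simplex"
  shows "\<mu> * norm (Dxstar f g H b *v z) \<le> norm1 z * (L * diameter (pareto_set g))"
  using strongly_convex_smooth.hessian_coercive[OF fbeta_strongly_convex_smooth[OF assms],
      of "Dxstar f g H b *v z" "xstar f b"]
    Hbeta_Dxstar[OF assms] norm_gbeta_xstar_le[OF assms, of z]
  by simp

lemma Dxstar_diff_apply_perturbation:
  fixes z :: "real^'n"
  assumes lip: "\<And>i x y. op_norm2 (H i x - H i y) \<le> L\<^sub>H * norm (x - y)"
    and b: "b \<in> std_simplex" and b': "b' \<in> std_simplex"
  defines "x \<equiv> xstar f b" and "x' \<equiv> xstar f b'" and "w \<equiv> Dxstar f g H b *v z"
  shows "\<mu> * norm ((Dxstar f g H b - Dxstar f g H b') *v z)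
    \<le> norm1 z * (L * norm (x - x')) + (L * norm1 (b - b') + L\<^sub>H * norm (x - x')) * norm w"
proof -
  define w' where "w' = Dxstar f g H b' *v z"
  have "\<mu> * norm (w' - w) \<le> norm (gbeta g z x - gbeta g z x') + norm ((Hbeta H b x - Hbeta H b' x') *v w)"
    using coercive_perturbation[where B = "Hbeta H b' x'" and A = "Hbeta H b x" and w' = w' and w = w,
        OF strongly_convex_smooth.hessian_coercive[OF fbeta_strongly_convex_smooth[OF b']]]
      Hbeta_Dxstar[OF b] Hbeta_Dxstar[OF b']
    by (simp add: x_def x'_def w_def w'_def)
  also have "\<dots> \<le> norm1 z * (L * norm (x - x')) + (L * norm1 (b - b') + L\<^sub>H * norm (x - x')) * norm w"
    by (intro add_mono gbeta_lipschitz Hbeta_diff_le[OF lip b'])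
  finally show ?thesis
    by (simp add: w_def w'_def matrix_vector_mult_diff_rdistrib norm_minus_commute)
qed

lemma Dxstar_diff_apply_le:
  assumes lip: "\<And>i x y. op_norm2 (H i x - H i y) \<le> L\<^sub>H * norm (x - y)"
    and R: "R = diameter (pareto_set g)"
    and b: "b \<in> std_simplex" and b': "b' \<in> std_simplex"
    and z: "norm1 z = 1"
  shows "norm ((Dxstar f g H b - Dxstar f g H b') *v z)
    \<le> 2 * L^2 * R / \<mu>^2 * (1 + L\<^sub>H * R / \<mu>) * norm1 (b - b')"
proof -
  define dx where "dx = norm (xstar f b - xstar f b')"
  define \<rho> where "\<rho> = L * R / \<mu>"
  define \<delta> where "\<delta> = norm1 (b - b')"
  have LH: "0 \<le> L\<^sub>H"
    using lip by (rule op_norm2_lipschitz_const_nonneg)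
  have \<rho>: "0 \<le> \<rho>"
    using mu_pos L_pos diameter_ge_0[OF bounded_pareto_set] by (simp add: \<rho>_def R)
  have \<delta>: "0 \<le> \<delta>"
    by (simp add: \<delta>_def norm1_nonneg)
  have dx: "dx \<le> \<rho> * \<delta>"
    using xstar_lipschitz[OF b b'] by (simp add: dx_def \<rho>_def \<delta>_def R)
  have w: "norm (Dxstar f g H b *v z) \<le> \<rho>"
    using norm_Dxstar_apply_le[OF b, of z] z mu_pos by (simp add: \<rho>_def R field_simps)
  have "\<mu> * norm ((Dxstar f g H b - Dxstar f g H b') *v z)
      \<le> L * dx + (L * \<delta> + L\<^sub>H * dx) * norm (Dxstar f g H b *v z)"
    using Dxstar_diff_apply_perturbation[OF lip b b', of z] z by (simp add: dx_def \<delta>_def)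
  also have "\<dots> \<le> L * (\<rho> * \<delta>) + (L * \<delta> + L\<^sub>H * (\<rho> * \<delta>)) * \<rho>"
    using L_pos LH \<delta> \<rho> dx w
    by (intro add_mono mult_left_mono mult_mono) auto
  also have "\<dots> \<le> \<mu> * (2 * L^2 * R / \<mu>^2 * (1 + L\<^sub>H * R / \<mu>) * \<delta>)"
  proof -
    have "0 \<le> L\<^sub>H * \<rho> * \<rho> * \<delta>"
      using LH \<rho> \<delta> by simp
    moreover have "\<mu> * (2 * L^2 * R / \<mu>^2 * (1 + L\<^sub>H * R / \<mu>) * \<delta>)
        = 2 * L * \<rho> * \<delta> + 2 * (L\<^sub>H * \<rho> * \<rho> * \<delta>)"
      using mu_pos by (simp add: \<rho>_def power2_eq_square field_simps)
    ultimately show ?thesis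
      by (simp add: algebra_simps)
  qed
  finally show ?thesis
    using mu_pos unfolding \<delta>_def by (rule mult_left_le_imp_le)
qed

end

theorem lemma9:
  fixes f :: "'n::finite \<Rightarrow> real^'d::finite \<Rightarrow> real"
    and g :: "'n \<Rightarrow> real^'d \<Rightarrow> real^'d"
    and H :: "'n \<Rightarrow> real^'d \<Rightarrow> real^'d^'d"
    and \<mu> L L\<^sub>H R :: real
  assumes grad: "\<And>i x. (f i has_derivative (\<lambda>h. g i x \<bullet> h)) (at x)"
    and hess: "\<And>i x. (g i has_derivative (\<lambda>h. H i x *v h)) (at x)"
    and mu_pos: "0 < \<mu>" and mu_le_L: "\<mu> \<le> L"
    and lower: "\<And>i x. loewner_le (\<mu> *\<^sub>R mat 1) (H i x)"
    and upper: "\<And>i x. loewner_le (H i x) (L *\<^sub>R mat 1)"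
    and lip: "\<And>i x y. op_norm2 (H i x - H i y) \<le> L\<^sub>H * norm (x - y)"
    and R_def: "R = diameter (pareto_set g)"
    and b1: "\<beta> \<in> std_simplex" and b2: "\<beta>' \<in> std_simplex"
  shows "norm12 (Dxstar f g H \<beta> - Dxstar f g H \<beta>')
         \<le> 2 * L^2 * R / \<mu>^2 * (1 + L\<^sub>H * R / \<mu>) * norm1 (\<beta> - \<beta>')"
proof -
  interpret family: strongly_convex_smooth_family f g H \<mu> L
    by (intro strongly_convex_smooth_family.intro strongly_convex_smooth_matrixI grad hess mu_pos
        mu_le_L lower upper)
  show ?thesis
    by (rule norm12_le) (rule family.Dxstar_diff_apply_le[OF lip R_def b1 b2])
qed

end
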